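(* Let $G$ be a finite group. Let $k(G)$ denote the number of conjugacy classes of $G$, and let $m(G)$ denote the least positive integer $n$ such that the union of any $n$ distinct non-trivial conjugacy classes of $G$ together with the identity element of $G$ is a subgroup of $G$. If $m(G)\ge 2$, then $m(G)=k(G)-1$.
   Context: For a finite group $G$, $k(G)$ is the total number of conjugacy classes of $G$ (including the class $\{1\}$ of the identity). A non-trivial conjugacy class is a conjugacy class other than $\{1\}$. The integer $m(G)$ is the least positive integer $n$ such that for every choice of $n$ distinct non-trivial conjugacy classes $C_1,\ldots,C_n$ of $G$, the set $\{1\}\cup C_1\cup\cdots\cup C_n$ is a subgroup of $G$. *)

theory Defs
  imports "HOL-Algebra.Group_Action"
begin

text \<open>The action is the one of the library theorem \<open>group.action_by_conjugation\<close>.\<close>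
definition conj_classes :: "('a, 'b) monoid_scheme \<Rightarrow> 'a set set"
  where "conj_classes G =
    orbits G (carrier G)
      (\<lambda>g. \<lambda>h \<in> carrier G. g \<otimes>\<^bsub>G\<^esub> h \<otimes>\<^bsub>G\<^esub> (inv\<^bsub>G\<^esub> g))"

definition class_number :: "('a, 'b) monoid_scheme \<Rightarrow> nat"
  where "class_number G = card (conj_classes G)"

definition nontrivial_classes :: "('a, 'b) monoid_scheme \<Rightarrow> 'a set set"
  where "nontrivial_classes G = conj_classes G - {{\<one>\<^bsub>G\<^esub>}}"

text \<open>
  A choice of \<open>n\<close> distinct classes is a set \<open>\<C>\<close> of classes with \<open>card \<C> = n\<close>;
  it is finite because \<open>n > 0\<close>. For a finite group the least \<open>n\<close> exists, since the
  condition holds vacuously as soon as \<open>n\<close> is at least the number of classes.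
\<close>
definition min_class_union :: "('a, 'b) monoid_scheme \<Rightarrow> nat"
  where "min_class_union G =
    (LEAST n. n > 0 \<and>
       (\<forall>\<C>. \<C> \<subseteq> nontrivial_classes G \<and> card \<C> = n
          \<longrightarrow> subgroup ({\<one>\<^bsub>G\<^esub>} \<union> \<Union>\<C>) G))"

end

theory Submission
  imports Defs
begin

text \<open>
  If every union of \<open>n + 1\<close> non-trivial classes with \<open>{1}\<close> is a subgroup and there are at least
  \<open>n + 2\<close> such classes, then a union of \<open>n\<close> classes is the intersection of two unions of \<open>n + 1\<close>
  classes, so it is a subgroup too. Hence a least number that is at least 2 must be the number
  of all non-trivial classes.
\<close>

lemma (in group) Union_conj_classes: "\<Union>(conj_classes G) = carrier G"
  unfolding conj_classes_def
  by (rule group_action.orbits_coverture[OF action_by_conjugation])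

lemma (in group) conj_classes_disjoint:
  assumes "A \<in> conj_classes G" "B \<in> conj_classes G" "A \<noteq> B"
  shows "A \<inter> B = {}"
  using group_action.disjoint_union[OF action_by_conjugation] assms
  unfolding conj_classes_def by blast

lemma (in group) one_class_in_conj_classes: "{\<one>} \<in> conj_classes G"
proof -
  let ?f = "\<lambda>g. \<lambda>h \<in> carrier G. g \<otimes> h \<otimes> inv g"
  have "orbit G ?f \<one> = {\<one>}"
    \<comment> \<open>Conjugation fixes \<open>\<one>\<close>; the witness \<open>\<one>\<close> as
      conjugating element shows that the orbit is not empty.\<close>
    unfolding orbit_def by (auto intro!: exI[of _ \<one>])
  then show ?thesis
    unfolding conj_classes_def orbits_def by blast
qed

lemma (in group) finite_conj_classes:
  assumes "finite (carrier G)"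
  shows "finite (conj_classes G)"
  using assms Union_conj_classes finite_UnionD by metis

text \<open>\<open>{\<one>}\<close> is itself a class, so removing it lowers the count by exactly
  one when there are finitely many classes; otherwise both sides are 0.\<close>

lemma (in group) card_nontrivial_classes:
  "card (nontrivial_classes G) = class_number G - 1"
  unfolding nontrivial_classes_def class_number_def
  using one_class_in_conj_classes by (simp add: card_Diff_singleton)

lemma (in group) one_Un_Union_nontrivial_classes:
  "{\<one>} \<union> \<Union>(nontrivial_classes G) = carrier G"
  using Union_conj_classes one_class_in_conj_classes
  unfolding nontrivial_classes_def by blast

lemma (in group) class_union_subgroup_step:
  assumes fin: "finite (carrier G)"
    and Suc_n: "\<And>\<C>. \<C> \<subseteq> nontrivial_classes G \<Longrightarrow> card \<C> = Suc n
      \<Longrightarrow> subgroup ({\<one>} \<union> \<Union>\<C>) G"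
    and more: "Suc n < card (nontrivial_classes G)"
    and \<C>: "\<C> \<subseteq> nontrivial_classes G" "card \<C> = n"
  shows "subgroup ({\<one>} \<union> \<Union>\<C>) G"
proof -
  let ?N = "nontrivial_classes G"
  have finN: "finite ?N"
    using finite_conj_classes[OF fin] by (simp add: nontrivial_classes_def)
  \<comment> \<open>For \<open>n = 0\<close> the cardinality alone would not give
    finiteness.\<close>
  then have fin\<C>: "finite \<C>"
    using \<C>(1) finite_subset by blast
  have "card (?N - \<C>) \<ge> 2"
    using card_Diff_subset[OF fin\<C> \<C>(1)] \<C>(2) more by simp
  then obtain A B where AB: "A \<in> ?N - \<C>" "B \<in> ?N - \<C>" "A \<noteq> B"
    by (meson card_2_iff' obtain_subset_with_card_n subset_iff)
  \<comment> \<open>Disjointness makes the intersection below lose everything that \<open>A\<close>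
    and \<open>B\<close> add to the union of \<open>\<C>\<close>.\<close>
  have "A \<inter> B = {}"
    using AB conj_classes_disjoint by (auto simp: nontrivial_classes_def)
  then have "{\<one>} \<union> \<Union>\<C> = ({\<one>} \<union> \<Union>(insert A \<C>)) \<inter> ({\<one>} \<union> \<Union>(insert B \<C>))"
    by blast
  moreover have "subgroup ({\<one>} \<union> \<Union>(insert A \<C>)) G" "subgroup ({\<one>} \<union> \<Union>(insert B \<C>)) G"
    using AB \<C> fin\<C> by (intro Suc_n; simp)+
  ultimately show ?thesis
    using subgroups_Inter_pair by metis
qed

theorem theorem2:
  fixes G :: "('a, 'b) monoid_scheme" (structure)
  assumes "group G"
    and "finite (carrier G)"
    and "min_class_union G \<ge> 2"
  shows "min_class_union G = class_number G - 1"
proof -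
  interpret group G by fact
  let ?N = "nontrivial_classes G"
  define P where "P n \<longleftrightarrow> n > 0 \<and>
    (\<forall>\<C>. \<C> \<subseteq> ?N \<and> card \<C> = n \<longrightarrow> subgroup ({\<one>} \<union> \<Union>\<C>) G)" for n
  have m: "min_class_union G = (LEAST n. P n)"
    by (simp add: min_class_union_def P_def)
  have finN: "finite ?N"
    using finite_conj_classes[OF assms(2)] by (simp add: nontrivial_classes_def)
  \<comment> \<open>Only \<open>?N\<close> itself can have that many members, and its union with
    \<open>{\<one>}\<close> is the whole group; beyond \<open>card ?N\<close> the condition is
    vacuous.\<close>
  have full: "P n" if "n > 0" "n \<ge> card ?N" for n
    unfolding P_def
  proof (intro conjI allI impI)
    fix \<C> assume "\<C> \<subseteq> ?N \<and> card \<C> = n"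
    then have "\<C> = ?N"
      using card_seteq[OF finN] that(2) by blast
    then show "subgroup ({\<one>} \<union> \<Union>\<C>) G"
      using one_Un_Union_nontrivial_classes subgroup_self by simp
  qed (fact that(1))
  have "\<not> P 1"
    using assms(3) Least_le[of P 1] m by auto
  \<comment> \<open>Without non-trivial classes, as in the trivial group, \<open>P 1\<close> would
    hold vacuously. Positivity makes \<open>card ?N\<close> a witness for \<open>P\<close>.\<close>
  then have pos: "card ?N > 0"
    using full[of 1] by (cases "card ?N") auto
  then have le: "min_class_union G \<le> card ?N"
    using m Least_le full by auto
  have Pm: "P (min_class_union G)"
    unfolding m using full[OF pos] by (rule LeastI) simp
  \<comment> \<open>Since \<open>n > 0\<close>, the failure of \<open>P n\<close> below means that
    some choice of \<open>n\<close> classes gives no subgroup; this is where the bound 2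
    matters.\<close>
  obtain n where n: "min_class_union G = Suc n" "n > 0"
    using assms(3) by (cases "min_class_union G") auto
  have "\<not> P n"
    using not_less_Least[of n P] n m by simp
  then have "\<not> Suc n < card ?N"
    using class_union_subgroup_step[OF assms(2), of n] Pm n unfolding P_def by metis
  then show ?thesis
    using le n card_nontrivial_classes by simp
qed

end
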